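(* Consider the mixed clock ensemble model, the observable canonical decomposition (associated with a weight vector $q\in\mathbb{R}^N$, $q^\top\mathbb{1}_N=1$) and the transformed state-space realization, all as defined in the context. Then the steady-state Kalman filtering algorithm for the transformed state-space realization is given as $$\begin{bmatrix}\hat\eta_o^-[k]\\ \hat\eta_{\bar o}^-[k]\end{bmatrix}=\begin{bmatrix}\mathbf{A}_{oo}&0\\ \mathbf{A}_{\bar oo}&A\end{bmatrix}\begin{bmatrix}\hat\eta_o[k-1]\\ \hat\eta_{\bar o}[k-1]\end{bmatrix}+\begin{bmatrix}\mathbf{B}_o\\ \mathbf{B}_{\bar o}\end{bmatrix}u[k-1],$$ $$\begin{bmatrix}\hat\eta_o[k]\\ \hat\eta_{\bar o}[k]\end{bmatrix}=\begin{bmatrix}\hat\eta_o^-[k]\\ \hat\eta_{\bar o}^-[k]\end{bmatrix}+\begin{bmatrix}L_o^*\\ L_{\bar o}^*\end{bmatrix}\left(y[k]-\mathbf{C}_o\hat\eta_o^-[k]\right),$$ where the observable and unobservable Kalman gains are, respectively, $$L_o^*=P_{oo}^*\mathbf{C}_o^\top\left(\mathbf{C}_oP_{oo}^*\mathbf{C}_o^\top+rI_{N-1}\right)^{-1},\qquad L_{\bar o}^*=P_{\bar oo}^*\mathbf{C}_o^\top\left(\mathbf{C}_oP_{oo}^*\mathbf{C}_o^\top+rI_{N-1}\right)^{-1},$$ with the steady-state matrices $P_{oo}^*$ and $P_{\bar oo}^*$ defined in the context.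
   Context: Ensemble. A mixed ensemble of $N$ clocks contains a mixture of cesium-type (second-order) and hydrogen-maser-type (third-order) clocks; the last $M>0$ clocks are hydrogen-maser-type and the first $N-M$ are cesium-type. $\tau$ is the constant sampling interval. $\mathbb{1}_n$ is the all-ones column vector, $\otimes$ the Kronecker product. Let $$A=\begin{bmatrix}1&\tau\\ 0&1\end{bmatrix},\ \beta=\begin{bmatrix}\tau^2/2\\ \tau\end{bmatrix},\ B=\begin{bmatrix}\tau\\ 1\end{bmatrix},\ C=\begin{bmatrix}1&0\end{bmatrix},\ J=\begin{bmatrix}0_{(N-M)\times M}\\ I_M\end{bmatrix}.$$ The ensemble state is $x[k]=[p[k]^\top\ f[k]^\top]^\top\in\mathbb{R}^{2N}$ (phase deviations $p[k]\in\mathbb{R}^N$, frequency states $f[k]\in\mathbb{R}^N$) and $z[k]\in\mathbb{R}^M$ (frequency drifts of the hydrogen-maser-type clocks), with input $u[k]\in\mathbb{R}^N$ and output $y[k]\in\mathbb{R}^{N-1}$: $$\begin{bmatrix}x[k+1]\\ z[k+1]\end{bmatrix}=\begin{bmatrix}A\otimes I_N&\beta\otimes J\\ 0&I_M\end{bmatrix}\begin{bmatrix}x[k]\\ z[k]\end{bmatrix}+\begin{bmatrix}B\otimes I_N\\ 0\end{bmatrix}u[k]+\begin{bmatrix}v^x[k]\\ v^z[k]\end{bmatrix},\quad y[k]=\begin{bmatrix}C\otimes V&0\end{bmatrix}\begin{bmatrix}x[k]\\ z[k]\end{bmatrix}+w[k],$$ where $V\in\mathbb{R}^{(N-1)\times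 N}$ satisfies $\ker V=\operatorname{im}\mathbb{1}_N$, $w$ is zero-mean white Gaussian noise with covariance $rI_{N-1}$, $r>0$, and the process noise $(v^x,v^z)$ is zero-mean white Gaussian with covariance (the clocks being independent of each other) $$Q=\begin{bmatrix}\tau\Sigma_1+\frac{\tau^3}{3}\Sigma_2+\frac{\tau^5}{20}\Sigma_3&\frac{\tau^2}{2}\Sigma_2+\frac{\tau^4}{8}\Sigma_3&\frac{\tau^3}{6}\Sigma_4\\ \frac{\tau^2}{2}\Sigma_2+\frac{\tau^4}{8}\Sigma_3&\tau\Sigma_2+\frac{\tau^3}{3}\Sigma_3&\frac{\tau^2}{2}\Sigma_4\\ \frac{\tau^3}{6}\Sigma_4^\top&\frac{\tau^2}{2}\Sigma_4^\top&\tau\Sigma_5\end{bmatrix},$$ with $\Sigma_1=\mathrm{diag}(\sigma_{1,1}^2,\dots,\sigma_{1,N}^2)$, $\Sigma_2=\mathrm{diag}(\sigma_{2,1}^2,\dots,\sigma_{2,N}^2)$, $\Sigma_5=\mathrm{diag}(\sigma_{3,N-M+1}^2,\dots,\sigma_{3,N}^2)$, $\Sigma_3=\mathrm{diag}(0_{(N-M)\times(N-M)},\Sigma_5)$, $\Sigma_4=\begin{bmatrix}0\\ \Sigma_5\end{bmatrix}\in\mathbb{R}^{N\times M}$. Here $\sigma_{1,i}$, $\sigma_{2,i}$, $\sigma_{3,i}$ are the standard deviations of the white frequency noise, random walk frequency noise and random run of frequency drift of clock $i$. Observable canonical decomposition. Let $q\in\mathbb{R}^N$ with $q^\top\mathbb{1}_N=1$,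 let $W\in\mathbb{R}^{N\times(N-1)}$ have full column rank with $q^\top W=0$, and let $V^+=W(VW)^{-1}$. The observable state $\eta_o[k]\in\mathbb{R}^{2(N-1)+M}$ and unobservable state $\eta_{\bar o}[k]\in\mathbb{R}^2$ are defined by $$\begin{bmatrix}x[k]\\ z[k]\end{bmatrix}=\mathbf{T}^{-1}\begin{bmatrix}\eta_o[k]\\ \eta_{\bar o}[k]\end{bmatrix},\quad \mathbf{T}^{-1}=\begin{bmatrix}I_2\otimes V^+&0&I_2\otimes\mathbb{1}_N\\ 0&I_M&0\end{bmatrix},\quad \mathbf{T}=\begin{bmatrix}\mathbf{T}_o\\ \mathbf{T}_{\bar o}\end{bmatrix},$$ $$\mathbf{T}_o=\begin{bmatrix}I_2\otimes V&0\\ 0&I_M\end{bmatrix},\qquad \mathbf{T}_{\bar o}=\begin{bmatrix}I_2\otimes q^\top&0_{2\times M}\end{bmatrix}.$$ The transformed state-space realization is $$\begin{bmatrix}\eta_o[k+1]\\ \eta_{\bar o}[k+1]\end{bmatrix}=\begin{bmatrix}\mathbf{A}_{oo}&0\\ \mathbf{A}_{\bar oo}&A\end{bmatrix}\begin{bmatrix}\eta_o[k]\\ \eta_{\bar o}[k]\end{bmatrix}+\begin{bmatrix}\mathbf{B}_o\\ \mathbf{B}_{\bar o}\end{bmatrix}u[k]+\mathbf{T}\begin{bmatrix}v^x[k]\\ v^z[k]\end{bmatrix},\quad y[k]=\begin{bmatrix}\mathbf{C}_o&0\end{bmatrix}\begin{bmatrix}\eta_o[k]\\ \eta_{\bar o}[k]\end{bmatrix}+w[k],$$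 $$\mathbf{A}_{oo}=\begin{bmatrix}A\otimes I_{N-1}&\beta\otimes VJ\\ 0&I_M\end{bmatrix},\ \mathbf{A}_{\bar oo}=\begin{bmatrix}0_{2\times2(N-1)}&\beta\otimes q^\top J\end{bmatrix},\ \mathbf{B}_o=\begin{bmatrix}B\otimes V\\ 0\end{bmatrix},\ \mathbf{B}_{\bar o}=B\otimes q^\top,\ \mathbf{C}_o=\begin{bmatrix}C\otimes I_{N-1}&0_{(N-1)\times M}\end{bmatrix}.$$ Time-varying Kalman filter for this realization. $\hat\eta_o^-[k],\hat\eta_{\bar o}^-[k]$ are prior and $\hat\eta_o[k],\hat\eta_{\bar o}[k]$ posterior estimates; $P^-_{oo}[k],P_{oo}[k]$ are the prior/posterior error covariances of the observable state, and $P^-_{\bar oo}[k],P_{\bar oo}[k]\in\mathbb{R}^{2\times(2(N-1)+M)}$ the prior/posterior error cross-covariances between unobservable and observable state. These satisfy $$P^-_{oo}[k]=\mathbf{A}_{oo}P_{oo}[k-1]\mathbf{A}_{oo}^\top+\mathbf{T}_oQ\mathbf{T}_o^\top,\quad P^-_{\bar oo}[k]=(\mathbf{A}_{\bar oo}P_{oo}[k-1]+AP_{\bar oo}[k-1])\mathbf{A}_{oo}^\top+\mathbf{T}_{\bar o}Q\mathbf{T}_o^\top,$$ $$L_o[k]=P^-_{oo}[k]\mathbf{C}_o^\top(\mathbf{C}_oP^-_{oo}[k]\mathbf{C}_o^\top+rI_{N-1})^{-1},\quad L_{\bar o}[k]=P^-_{\bar oo}[k]\mathbf{C}_o^\top(\mathbf{C}_oP^-_{oo}[k]\mathbf{C}_o^\top+rI_{N-1})^{-1},$$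 $$P_{oo}[k]=(I-L_o[k]\mathbf{C}_o)P^-_{oo}[k],\quad P_{\bar oo}[k]=P^-_{\bar oo}[k](I-\mathbf{C}_o^\top L_o[k]^\top),$$ and the estimates are propagated as in the claim but with the time-varying gains $L_o[k],L_{\bar o}[k]$ in place of $L_o^*,L_{\bar o}^*$. Steady-state quantities. $P^-_{oo}[k]$ and $P^-_{\bar oo}[k]$ converge to steady-state values, denoted $$P^*_{oo}=\lim_{k\to\infty}P^-_{oo}[k],\qquad P^*_{\bar oo}=\lim_{k\to\infty}P^-_{\bar oo}[k],$$ and $\lim_{k\to\infty}L_o[k]=L_o^*$. Here $P^*_{oo}$ is the unique solution of the Riccati equation $$P^*_{oo}=\mathbf{T}_oQ\mathbf{T}_o^\top+\mathbf{A}_{oo}P^*_{oo}\mathbf{A}_{oo}^\top-\mathbf{A}_{oo}P^*_{oo}\mathbf{C}_o^\top\left(\mathbf{C}_oP^*_{oo}\mathbf{C}_o^\top+rI_{N-1}\right)^{-1}\mathbf{C}_oP^*_{oo}\mathbf{A}_{oo}^\top,$$ and $P^*_{\bar oo}$ satisfies $$P^*_{\bar oo}=\mathbf{T}_{\bar o}Q\mathbf{T}_o^\top+AP^*_{\bar oo}\mathbf{A}_{oo}^\top-AP^*_{\bar oo}\mathbf{C}_o^\top(L_o^* )^\top\mathbf{A}_{oo}^\top+\mathbf{A}_{\bar oo}P^*_{oo}\mathbf{A}_{oo}^\top-\mathbf{A}_{\bar oo}L_o^*\mathbf{C}_oP^*_{oo}\mathbf{A}_{oo}^\top.$$ *)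

theory Defs
  imports "HOL-Probability.Probability"
begin

section \<open>Block matrices and Kronecker products\<close>

text \<open>
  A matrix with \<open>m\<close> rows and \<open>n\<close> columns has type \<open>real^'n^'m\<close>.  Stacking is indexed by sum
  types and the Kronecker product by product types, with the index of the first factor as the
  outer one.
\<close>

definition vjoin :: "real^'a \<Rightarrow> real^'b \<Rightarrow> real^('a + 'b)" where
  "vjoin x y = (\<chi> i. case i of Inl a \<Rightarrow> x $ a | Inr b \<Rightarrow> y $ b)"

definition vstack :: "real^'n^'a \<Rightarrow> real^'n^'b \<Rightarrow> real^'n^('a + 'b)" where
  "vstack X Y = (\<chi> i. case i of Inl a \<Rightarrow> X $ a | Inr b \<Rightarrow> Y $ b)"

definition hstack :: "real^'a^'m \<Rightarrow> real^'b^'m \<Rightarrow> real^('a + 'b)^'m" where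
  "hstack X Y = (\<chi> i. vjoin (X $ i) (Y $ i))"

definition block ::
    "real^'a^'c \<Rightarrow> real^'b^'c \<Rightarrow> real^'a^'d \<Rightarrow> real^'b^'d \<Rightarrow> real^('a + 'b)^('c + 'd)" where
  "block X11 X12 X21 X22 = vstack (hstack X11 X12) (hstack X21 X22)"

definition kron :: "real^'b^'a \<Rightarrow> real^'d^'c \<Rightarrow> real^('b \<times> 'd)^('a \<times> 'c)" (infixl \<open>\<otimes>\<^sub>K\<close> 75) where
  "X \<otimes>\<^sub>K Y = (\<chi> i j. X $ fst i $ fst j * Y $ snd i $ snd j)"

text \<open>\<open>flatten\<close> turns a matrix whose entries are matrices of equal size into one matrix.\<close>

definition flatten :: "((real^'d^'c)^'b)^'a \<Rightarrow> real^('b \<times> 'd)^('a \<times> 'c)" where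
  "flatten X = (\<chi> i j. X $ fst i $ fst j $ snd i $ snd j)"

text \<open>
  When a factor has a single row or column, its index type \<open>1\<close> is dropped from the product index
  type, on the left (\<open>l\<close>) or on the right (\<open>r\<close>).
\<close>

definition col1l :: "real^(1 \<times> 'n)^'m \<Rightarrow> real^'n^'m" where
  "col1l X = (\<chi> i j. X $ i $ (1, j))"

definition col1r :: "real^('n::finite \<times> 1)^'m \<Rightarrow> real^'n^'m" where
  "col1r X = (\<chi> i j. X $ i $ (j, 1))"

definition row1l :: "real^'n^(1 \<times> 'm) \<Rightarrow> real^'n^'m" where
  "row1l X = (\<chi> i. X $ (1, i))"

definition row1r :: "real^'n^('m::finite \<times> 1) \<Rightarrow> real^'n^'m" where
  "row1r X = (\<chi> i. X $ (i, 1))"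

definition diag_mat :: "real^'n \<Rightarrow> real^'n^'n" where
  "diag_mat v = (\<chi> i j. if i = j then v $ i else 0)"


subsection \<open>Algebraic rules\<close>

lemma sum_UNIV_Plus: "(\<Sum>i\<in>(UNIV::('a::finite + 'b::finite) set). f i) = (\<Sum>a\<in>UNIV. f (Inl a)) + (\<Sum>b\<in>UNIV. f (Inr b))"
  for f :: "'a::finite + 'b::finite \<Rightarrow> real"
  by (simp flip: UNIV_Plus_UNIV add: sum.Plus comp_def)

lemma vec_sum_eq_iff: "x = y \<longleftrightarrow> (\<forall>a. x $ Inl a = y $ Inl a) \<and> (\<forall>b. x $ Inr b = y $ Inr b)"
  for x y :: "'x ^ ('a::finite + 'b::finite)"
  by (metis sum.exhaust vec_eq_iff)

lemma all_sum_iff: "(\<forall>i :: 'a + 'b. P i) \<longleftrightarrow> (\<forall>a. P (Inl a)) \<and> (\<forall>b. P (Inr b))" by (metis sum.exhaust)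

lemma vjoin_nth [simp]: "vjoin x y $ Inl a = x $ a" "vjoin x y $ Inr b = y $ b"
  by (simp_all add: vjoin_def)

lemma vstack_nth [simp]: "vstack X Y $ Inl a = X $ a" "vstack X Y $ Inr b = Y $ b"
  by (simp_all add: vstack_def)

lemma hstack_nth [simp]: "hstack X Y $ i = vjoin (X $ i) (Y $ i)"
  by (simp add: hstack_def)

lemma vstack_mult: "vstack X Y ** Z = vstack (X ** Z) (Y ** Z)"
  by (simp add: vec_sum_eq_iff vec_eq_iff matrix_matrix_mult_def)

lemma vstack_mult_vec: "vstack X Y *v z = vjoin (X *v z) (Y *v z)"
  by (simp add: vec_sum_eq_iff vec_eq_iff matrix_vector_mult_def)

lemma hstack_mult_vstack: "hstack X Y ** vstack Z W = X ** Z + Y ** W"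
  by (simp add: vec_eq_iff matrix_matrix_mult_def sum_UNIV_Plus)

lemma mult_hstack: "X ** hstack Y Z = hstack (X ** Y) (X ** Z)"
  by (simp add: vec_sum_eq_iff vec_eq_iff matrix_matrix_mult_def)

lemma hstack_mult_vjoin: "hstack X Y *v vjoin x y = X *v x + Y *v y"
  by (simp add: vec_eq_iff matrix_vector_mult_def sum_UNIV_Plus)

lemma hstack_add: "hstack X Y + hstack X' Y' = hstack (X + X') (Y + Y')"
  by (simp add: vec_sum_eq_iff vec_eq_iff)

lemma kron_mult: "(X \<otimes>\<^sub>K Y) ** (Z \<otimes>\<^sub>K W) = (X ** Z) \<otimes>\<^sub>K (Y ** W)"
  by (simp add: vec_eq_iff kron_def matrix_matrix_mult_def sum_product sum.cartesian_product
      case_prod_beta algebra_simps flip: UNIV_Times_UNIV)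

lemma kron_mat1: "mat 1 \<otimes>\<^sub>K mat 1 = mat 1"
  by (simp add: vec_eq_iff kron_def mat_def prod_eq_iff)

lemma kron_0 [simp]: "X \<otimes>\<^sub>K 0 = 0" by (simp add: vec_eq_iff kron_def)

lemma mult_col1l: "X ** col1l Y = col1l (X ** Y)"
  by (simp add: vec_eq_iff col1l_def matrix_matrix_mult_def)

lemma mult_col1r: "X ** col1r Y = col1r (X ** Y)"
  by (simp add: vec_eq_iff col1r_def matrix_matrix_mult_def)

lemma row1l_mult: "row1l X ** Y = row1l (X ** Y)"
  by (simp add: vec_eq_iff row1l_def matrix_matrix_mult_def)

lemma row1r_mult: "row1r X ** Y = row1r (X ** Y)"
  by (simp add: vec_eq_iff row1r_def matrix_matrix_mult_def)

lemma row1r_col1l: "row1r (col1l X) = col1l (row1r X)"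
  by (simp add: vec_eq_iff row1r_def col1l_def)

lemma sum_UNIV_prod1: "(\<Sum>i\<in>(UNIV::('a::finite \<times> 1) set). f i) = (\<Sum>a\<in>UNIV. f (a, 1))"
  for f :: "'a::finite \<times> 1 \<Rightarrow> real"
  by (rule sum.reindex_bij_witness[of _ "\<lambda>a. (a, 1)" fst]) (auto simp: prod_eq_iff intro!: arg_cong[where f = f])

lemma mult_row1r: "X ** row1r Y = row1r ((X \<otimes>\<^sub>K mat 1) ** Y)"
  by (simp add: vec_eq_iff row1r_def kron_def matrix_matrix_mult_def mat_def sum_UNIV_prod1)

lemma drop1_0 [simp]: "row1r 0 = 0" "col1r 0 = 0" "row1l 0 = 0"  "col1l 0 = 0"
  by (simp_all add: vec_eq_iff row1r_def col1r_def row1l_def col1l_def)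

lemma col1r_row1r_mat1: "col1r (row1r (mat 1)) = mat 1"
  by (simp add: vec_eq_iff row1r_def col1r_def mat_def)


section \<open>The mixed clock ensemble\<close>

text \<open>
  Clocks are indexed by \<open>'c + 'm\<close>: the cesium-type clocks by \<open>'c\<close>, followed by the
  hydrogen-maser-type clocks, indexed by \<open>'m\<close>.  Hence \<open>N = CARD('c + 'm)\<close>, \<open>M = CARD('m) > 0\<close>
  and \<open>N - M = CARD('c) > 0\<close>.  The index type \<open>'d\<close> of the \<open>N - 1\<close> phase differences is
  constrained by \<open>CARD('d) = CARD('c + 'm) - 1\<close>.

  The phase deviations and frequency states form a single vector \<open>x\<close> indexed by \<open>2 \<times> ('c + 'm)\<close>,
  where \<open>x $ (1, i)\<close> is the phase deviation and \<open>x $ (2, i)\<close> the frequency state of clock \<open>i\<close>.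

  The constant \<open>1\<close> of type \<open>real^'n\<close> is the all-ones vector; the identity matrix is \<open>mat 1\<close>.
\<close>

definition A_mat :: "real \<Rightarrow> real^2^2" where
  "A_mat \<tau> = vector [vector [1, \<tau>], vector [0, 1]]"

definition beta_mat :: "real \<Rightarrow> real^1^2" where
  "beta_mat \<tau> = columnvector (vector [\<tau>\<^sup>2 / 2, \<tau>])"

definition B_mat :: "real \<Rightarrow> real^1^2" where
  "B_mat \<tau> = columnvector (vector [\<tau>, 1])"

definition C_mat :: "real^2^1" where
  "C_mat = rowvector (vector [1, 0])"

definition J_mat :: "real^'m^('c::finite + 'm)" where
  "J_mat = vstack 0 (mat 1)"

definition state_mat :: "real \<Rightarrow> real^(2 \<times> ('c::finite + 'm::finite) + 'm)^(2 \<times> ('c + 'm) + 'm)" where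
  "state_mat \<tau> = block (A_mat \<tau> \<otimes>\<^sub>K mat 1) (col1l (beta_mat \<tau> \<otimes>\<^sub>K J_mat)) 0 (mat 1)"

definition input_mat :: "real \<Rightarrow> real^('c::finite + 'm::finite)^(2 \<times> ('c + 'm) + 'm)" where
  "input_mat \<tau> = vstack (col1l (B_mat \<tau> \<otimes>\<^sub>K mat 1)) 0"

definition output_mat :: "real^('c::finite + 'm::finite)^'d \<Rightarrow> real^(2 \<times> ('c + 'm) + 'm)^'d" where
  "output_mat V = hstack (row1l (C_mat \<otimes>\<^sub>K V)) 0"

text \<open>
  The arguments \<open>s1\<close>, \<open>s2\<close>, \<open>s3\<close> are the standard deviations of the white frequency noise, the
  random walk frequency noise and the random run of frequency drift.
\<close>

definition Sigma_diag :: "real^'n \<Rightarrow> real^'n^'n" where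
  "Sigma_diag s = diag_mat (\<chi> i. (s $ i)\<^sup>2)"

definition Sigma3 :: "real^'m \<Rightarrow> real^('c::finite + 'm)^('c + 'm)" where
  "Sigma3 s3 = block 0 0 0 (Sigma_diag s3)"

definition Sigma4 :: "real^'m \<Rightarrow> real^'m^('c::finite + 'm)" where
  "Sigma4 s3 = vstack 0 (Sigma_diag s3)"

definition Q_mat ::
    "real \<Rightarrow> real^('c::finite + 'm::finite) \<Rightarrow> real^('c + 'm) \<Rightarrow> real^'m
      \<Rightarrow> real^(2 \<times> ('c + 'm) + 'm)^(2 \<times> ('c + 'm) + 'm)" where
  "Q_mat \<tau> s1 s2 s3 =
    (let S1 = Sigma_diag s1; S2 = Sigma_diag s2; S3 = Sigma3 s3; S4 = Sigma4 s3;
         S5 = Sigma_diag s3 in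
     block
       (flatten (vector
         [vector [\<tau> *\<^sub>R S1 + (\<tau>^3 / 3) *\<^sub>R S2 + (\<tau>^5 / 20) *\<^sub>R S3, (\<tau>\<^sup>2 / 2) *\<^sub>R S2 + (\<tau>^4 / 8) *\<^sub>R S3],
          vector [(\<tau>\<^sup>2 / 2) *\<^sub>R S2 + (\<tau>^4 / 8) *\<^sub>R S3,               \<tau> *\<^sub>R S2 + (\<tau>^3 / 3) *\<^sub>R S3]]))
       (col1l (flatten (vector [vector [(\<tau>^3 / 6) *\<^sub>R S4], vector [(\<tau>\<^sup>2 / 2) *\<^sub>R S4]])))
       (row1l (flatten (vector [vector [(\<tau>^3 / 6) *\<^sub>R transpose S4, (\<tau>\<^sup>2 / 2) *\<^sub>R transpose S4]])))
       (\<tau> *\<^sub>R S5))"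

text \<open>
  Zero-mean Gaussian vectors are defined by the characteristic functions of their linear
  functionals, so that the covariance \<open>S\<close> may be singular.
\<close>

definition gaussian_vector :: "'w measure \<Rightarrow> ('w \<Rightarrow> real^'n) \<Rightarrow> real^'n^'n \<Rightarrow> bool" where
  "gaussian_vector \<Omega> X S \<longleftrightarrow> X \<in> borel_measurable \<Omega> \<and>
    (\<forall>a t. char (distr \<Omega> borel (\<lambda>\<omega>. a \<bullet> X \<omega>)) t = of_real (exp (- (t\<^sup>2 * (a \<bullet> (S *v a)) / 2))))"

text \<open>\<open>prob_space.indep_var\<close> requires both variables to have the same type of values.\<close>

definition independent_rv ::
    "'w measure \<Rightarrow> 'a measure \<Rightarrow> ('w \<Rightarrow> 'a) \<Rightarrow> 'b measure \<Rightarrow> ('w \<Rightarrow> 'b) \<Rightarrow> bool" where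
  "independent_rv \<Omega> M X N Y \<longleftrightarrow> X \<in> measurable \<Omega> M \<and> Y \<in> measurable \<Omega> N \<and>
    prob_space.indep_set \<Omega> (sets (vimage_algebra (space \<Omega>) X M)) (sets (vimage_algebra (space \<Omega>) Y N))"

text \<open>
  \<open>clock_noise\<close>: the process noise \<open>v\<close> and the measurement noise \<open>w\<close> are zero-mean, white and
  Gaussian with covariances \<open>Q\<close> and \<open>r I\<close>.  The first two conjuncts together say that all the
  vectors \<open>v 0, w 0, v 1, w 1, \<dots>\<close> are mutually independent.
\<close>

definition clock_noise ::
    "'w measure \<Rightarrow> real^'s^'s \<Rightarrow> real \<Rightarrow> (nat \<Rightarrow> 'w \<Rightarrow> real^'s) \<Rightarrow> (nat \<Rightarrow> 'w \<Rightarrow> real^'d) \<Rightarrow> bool" where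
  "clock_noise \<Omega> Q r v w \<longleftrightarrow>
    prob_space.indep_vars \<Omega> (\<lambda>_. borel) (\<lambda>k \<omega>. (v k \<omega>, w k \<omega>)) UNIV \<and>
    (\<forall>k. independent_rv \<Omega> borel (v k) borel (w k)) \<and>
    (\<forall>k. gaussian_vector \<Omega> (v k) Q) \<and>
    (\<forall>k. gaussian_vector \<Omega> (w k) (r *\<^sub>R mat 1))"

definition mixed_clock_ensemble ::
    "'w measure \<Rightarrow> real \<Rightarrow> real \<Rightarrow> real^('c::finite + 'm::finite) \<Rightarrow> real^('c + 'm) \<Rightarrow> real^'m \<Rightarrow> real^('c + 'm)^'d
      \<Rightarrow> (nat \<Rightarrow> 'w \<Rightarrow> real^(2 \<times> ('c + 'm))) \<Rightarrow> (nat \<Rightarrow> 'w \<Rightarrow> real^'m)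
      \<Rightarrow> (nat \<Rightarrow> 'w \<Rightarrow> real^('c + 'm)) \<Rightarrow> (nat \<Rightarrow> 'w \<Rightarrow> real^'d)
      \<Rightarrow> (nat \<Rightarrow> 'w \<Rightarrow> real^(2 \<times> ('c + 'm))) \<Rightarrow> (nat \<Rightarrow> 'w \<Rightarrow> real^'m)
      \<Rightarrow> (nat \<Rightarrow> 'w \<Rightarrow> real^'d) \<Rightarrow> bool" where
  "mixed_clock_ensemble \<Omega> \<tau> r s1 s2 s3 V x z u y vx vz w \<longleftrightarrow>
    prob_space \<Omega> \<and> \<tau> > 0 \<and> r > 0 \<and>
    (\<forall>i. s1 $ i \<ge> 0) \<and> (\<forall>i. s2 $ i \<ge> 0) \<and> (\<forall>i. s3 $ i \<ge> 0) \<and>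
    CARD('d) = CARD('c + 'm) - 1 \<and> {p. V *v p = 0} = span {1} \<and>
    clock_noise \<Omega> (Q_mat \<tau> s1 s2 s3) r (\<lambda>k \<omega>. vjoin (vx k \<omega>) (vz k \<omega>)) w \<and>
    (\<forall>\<omega>\<in>space \<Omega>. \<forall>k.
      vjoin (x (Suc k) \<omega>) (z (Suc k) \<omega>) =
        state_mat \<tau> *v vjoin (x k \<omega>) (z k \<omega>) + input_mat \<tau> *v u k \<omega> + vjoin (vx k \<omega>) (vz k \<omega>) \<and>
      y k \<omega> = output_mat V *v vjoin (x k \<omega>) (z k \<omega>) + w k \<omega>)"


section \<open>The observable canonical decomposition\<close>

definition decomposition_weights :: "real^'n^'d \<Rightarrow> real^'n \<Rightarrow> real^'d^'n \<Rightarrow> bool" where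
  "decomposition_weights V q W \<longleftrightarrow> q \<bullet> 1 = 1 \<and> rank W = CARD('d) \<and> q v* W = 0"

definition V_plus :: "real^'n^'d \<Rightarrow> real^'d^'n \<Rightarrow> real^'d^'n" where
  "V_plus V W = W ** matrix_inv (V ** W)"

definition T_inv ::
    "real^('c::finite + 'm::finite)^'d \<Rightarrow> real^'d^('c + 'm)
      \<Rightarrow> real^((2 \<times> 'd + 'm) + 2)^(2 \<times> ('c + 'm) + 'm)" where
  "T_inv V W =
    block (hstack (mat 1 \<otimes>\<^sub>K V_plus V W) 0) (col1r (mat 1 \<otimes>\<^sub>K columnvector 1))
          (hstack 0 (mat 1))                0"

definition T_o :: "real^('c::finite + 'm::finite)^'d \<Rightarrow> real^(2 \<times> ('c + 'm) + 'm)^(2 \<times> 'd + 'm)" where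
  "T_o V = block (mat 1 \<otimes>\<^sub>K V) 0 0 (mat 1)"

definition T_ob :: "real^('c::finite + 'm::finite) \<Rightarrow> real^(2 \<times> ('c + 'm) + 'm)^2" where
  "T_ob q = hstack (row1r (mat 1 \<otimes>\<^sub>K rowvector q)) 0"

definition A_oo :: "real \<Rightarrow> real^('c::finite + 'm::finite)^'d \<Rightarrow> real^(2 \<times> 'd + 'm)^(2 \<times> 'd + 'm)" where
  "A_oo \<tau> V = block (A_mat \<tau> \<otimes>\<^sub>K mat 1) (col1l (beta_mat \<tau> \<otimes>\<^sub>K (V ** J_mat))) 0 (mat 1)"

definition A_obo :: "real \<Rightarrow> real^('c::finite + 'm::finite) \<Rightarrow> real^(2 \<times> 'd::finite + 'm)^2" where
  "A_obo \<tau> q = hstack 0 (col1l (row1r (beta_mat \<tau> \<otimes>\<^sub>K (rowvector q ** J_mat))))"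

definition B_o :: "real \<Rightarrow> real^('c::finite + 'm::finite)^'d \<Rightarrow> real^('c + 'm)^(2 \<times> 'd + 'm)" where
  "B_o \<tau> V = vstack (col1l (B_mat \<tau> \<otimes>\<^sub>K V)) 0"

definition B_ob :: "real \<Rightarrow> real^('c::finite + 'm::finite) \<Rightarrow> real^('c + 'm)^2" where
  "B_ob \<tau> q = col1l (row1r (B_mat \<tau> \<otimes>\<^sub>K rowvector q))"

definition C_o :: "real^(2 \<times> 'd::finite + 'm::finite)^'d" where
  "C_o = hstack (row1l (C_mat \<otimes>\<^sub>K mat 1)) 0"

definition transformed_realization ::
    "real \<Rightarrow> real^('c::finite + 'm::finite)^'d \<Rightarrow> real^('c + 'm)
      \<Rightarrow> (nat \<Rightarrow> real^(2 \<times> 'd + 'm)) \<Rightarrow> (nat \<Rightarrow> real^2)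
      \<Rightarrow> (nat \<Rightarrow> real^('c + 'm)) \<Rightarrow> (nat \<Rightarrow> real^'d)
      \<Rightarrow> (nat \<Rightarrow> real^(2 \<times> ('c + 'm) + 'm)) \<Rightarrow> (nat \<Rightarrow> real^'d) \<Rightarrow> bool" where
  "transformed_realization \<tau> V q eo eob u y v w \<longleftrightarrow> (\<forall>k.
      vjoin (eo (Suc k)) (eob (Suc k)) =
        block (A_oo \<tau> V) 0 (A_obo \<tau> q) (A_mat \<tau>) *v vjoin (eo k) (eob k)
        + vstack (B_o \<tau> V) (B_ob \<tau> q) *v u k + vstack (T_o V) (T_ob q) *v v k \<and>
      y k = hstack C_o 0 *v vjoin (eo k) (eob k) + w k)"

lemma V_V_plus:
  fixes V :: "real^'n^'d" and W :: "real^'d^'n"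
  assumes ker: "{p. V *v p = 0} = span {1}" and dw: "decomposition_weights V q W"
  shows "V ** V_plus V W = mat 1" "rowvector q ** V_plus V W = (0 :: real^'d^1)" "V *v 1 = 0"
proof -
  have q: "q \<bullet> 1 = 1" "q v* W = 0" and rk: "rank W = CARD('d)"
    using dw by (auto simp: decomposition_weights_def)
  have injW: "inj ((*v) W)" using rk by (simp add: full_rank_injective)
  have "x = 0" if "(V ** W) *v x = 0" for x
  proof -
    have "W *v x \<in> span {1}" using that ker by (simp flip: matrix_vector_mul_assoc) blast
    then obtain c where c: "W *v x = c *\<^sub>R 1" by (auto simp: span_singleton)
    have "q \<bullet> (W *v x) = 0" by (simp add: q flip: dot_lmul_matrix)
    then have "W *v x = 0" using c q by simp
    then show "x = 0" using injW by (metis injD matrix_vector_mult_0_right)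
  qed
  then have "inj ((*v) (V ** W))" by (meson inj_matrix_vector_mult matrix_left_invertible_ker matrix_left_invertible_injective)
  then have "invertible (V ** W)" by (metis invertible_left_inverse matrix_left_invertible_injective)
  then have mi: "(V ** W) ** matrix_inv (V ** W) = mat 1"
    unfolding matrix_inv_def invertible_def by (rule someI2_ex) simp
  then show "V ** V_plus V W = mat 1"
    by (simp add: V_plus_def matrix_mul_assoc mi)
  have "rowvector q ** W = (0 :: real^'d^1)"
    using q(2) by (simp add: vec_eq_iff rowvector_def matrix_matrix_mult_def vector_matrix_mult_def)
  then show "rowvector q ** V_plus V W = (0 :: real^'d^1)"
    by (simp add: V_plus_def matrix_mul_assoc)
  show "V *v 1 = 0" using ker span_base[of "1" "{1}"] by blast
qed

lemma vjoin_eq_iff: "vjoin a b = vjoin c d \<longleftrightarrow> a = c \<and> b = d"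
  by (auto simp: vec_sum_eq_iff vec_eq_iff)

lemma T_T_inv:
  fixes V :: "real^('c::finite + 'm::finite)^'d"
  assumes "{p. V *v p = 0} = span {1}" "decomposition_weights V q W"
  shows "T_o V *v (T_inv V W *v vjoin a b) = a" "T_ob q *v (T_inv V W *v vjoin a b) = b"
proof -
  note V = V_V_plus[OF assms]
  have q1: "rowvector q ** columnvector 1 = (mat 1 :: real^1^1)"
    using assms(2) by (simp add: decomposition_weights_def vec_eq_iff rowvector_def columnvector_def
      matrix_matrix_mult_def mat_def inner_vec_def num1_eq_iff)
  have V1: "V ** columnvector 1 = (0 :: real^1^'d)"
    using V(3) by (simp flip: dot_rowvector_columnvector) (simp add: columnvector_def vec_eq_iff)
  have To: "T_o V ** T_inv V W = hstack (mat 1) 0"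
    by (simp add: T_o_def T_inv_def block_def vstack_mult hstack_mult_vstack mult_hstack hstack_add
       kron_mult V kron_mat1 mult_col1r V1 vec_sum_eq_iff)
     (simp add: vec_eq_iff[where 'b="2 \<times> 'd"] vec_eq_iff[where 'b='m] vec_eq_iff[where 'b="2 \<times> 'd + 'm"] all_sum_iff mat_def)
  have Tob: "T_ob q ** T_inv V W = hstack 0 (mat 1)"
    by (simp add: T_ob_def T_inv_def block_def vstack_mult hstack_mult_vstack mult_hstack hstack_add
       kron_mult row1r_mult V kron_mat1 mult_col1r q1 col1r_row1r_mat1)
     (simp add: vec_eq_iff[where 'b=2] vec_eq_iff[where 'b="(2 \<times> 'd + 'm) + 2"] all_sum_iff mat_def)
  show "T_o V *v (T_inv V W *v vjoin a b) = a" "T_ob q *v (T_inv V W *v vjoin a b) = b"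
    by (simp_all add: matrix_vector_mul_assoc To Tob hstack_mult_vjoin)
qed

lemma T_intertwines:
  "T_o V ** state_mat \<tau> = A_oo \<tau> V ** T_o V"
  "T_ob q ** state_mat \<tau> = A_obo \<tau> q ** T_o V + A_mat \<tau> ** T_ob q"
  "T_o V ** input_mat \<tau> = B_o \<tau> V"
  "T_ob q ** input_mat \<tau> = B_ob \<tau> q"
  "output_mat V = C_o ** T_o V"
  by (simp_all add: T_o_def T_ob_def state_mat_def A_oo_def A_obo_def B_o_def B_ob_def input_mat_def
    output_mat_def C_o_def block_def vstack_mult hstack_mult_vstack mult_hstack hstack_add
       kron_mult row1r_mult row1l_mult mult_col1l row1r_col1l mult_row1r)

theorem transformed_realization_of_ensemble:
  fixes V :: "real^('c::finite + 'm::finite)^'d"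
  assumes ens: "mixed_clock_ensemble \<Omega> \<tau> r s1 s2 s3 V x z u y vx vz w"
    and dw: "decomposition_weights V q W"
    and eta: "\<And>k \<omega>. \<omega> \<in> space \<Omega> \<Longrightarrow>
      vjoin (x k \<omega>) (z k \<omega>) = T_inv V W *v vjoin (eo k \<omega>) (eob k \<omega>)"
    and om: "\<omega> \<in> space \<Omega>"
  shows "transformed_realization \<tau> V q (\<lambda>k. eo k \<omega>) (\<lambda>k. eob k \<omega>) (\<lambda>k. u k \<omega>) (\<lambda>k. y k \<omega>)
     (\<lambda>k. vjoin (vx k \<omega>) (vz k \<omega>)) (\<lambda>k. w k \<omega>)"
proof -
  have ker: "{p. V *v p = 0} = span {1}" using ens by (simp add: mixed_clock_ensemble_def)
  let ?X = "\<lambda>k. vjoin (x k \<omega>) (z k \<omega>)"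
  have eo: "eo k \<omega> = T_o V *v ?X k" and eob: "eob k \<omega> = T_ob q *v ?X k" for k
    by (simp_all add: eta[OF om] T_T_inv[OF ker dw])
  have dyn: "?X (Suc k) = state_mat \<tau> *v ?X k + input_mat \<tau> *v u k \<omega> + vjoin (vx k \<omega>) (vz k \<omega>)"
    and out: "y k \<omega> = output_mat V *v ?X k + w k \<omega>" for k
    using ens om by (auto simp: mixed_clock_ensemble_def)
  have add: "vjoin a b + vjoin c d = vjoin (a + c) (b + d)" for a c :: "real^(2 \<times> 'd + 'm)" and b d :: "real^2"
    by (simp add: vec_sum_eq_iff vec_eq_iff)
  show ?thesis
    unfolding transformed_realization_def
    by (simp add: eo eob out dyn block_def vstack_mult_vec hstack_mult_vjoin vjoin_eq_iff add
      matrix_vector_right_distrib matrix_vector_mul_assoc T_intertwines(1,3-5) T_intertwines(2)[of q \<tau> V] matrix_vector_mult_add_rdistrib)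
qed


section \<open>Kalman filtering for the transformed realization\<close>

definition covariance_mat :: "'w measure \<Rightarrow> ('w \<Rightarrow> real^'a) \<Rightarrow> ('w \<Rightarrow> real^'b) \<Rightarrow> real^'b^'a" where
  "covariance_mat \<Omega> X Y = (\<chi> i j.
     (\<integral>\<omega>. (X \<omega> $ i - (\<integral>\<omega>'. X \<omega>' $ i \<partial>\<Omega>)) * (Y \<omega> $ j - (\<integral>\<omega>'. Y \<omega>' $ j \<partial>\<Omega>)) \<partial>\<Omega>))"

definition square_integrable :: "'w measure \<Rightarrow> ('w \<Rightarrow> real^'a) \<Rightarrow> bool" where
  "square_integrable \<Omega> X \<longleftrightarrow> X \<in> borel_measurable \<Omega> \<and> integrable \<Omega> (\<lambda>\<omega>. (norm (X \<omega>))\<^sup>2)"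

text \<open>
  In the names below, \<open>_m\<close> marks prior quantities (written with a superscript minus sign in the
  literature), \<open>ob\<close> the unobservable state and \<open>Pob\<close> the error cross-covariance between the
  unobservable and the observable state.  The filter starts from posterior data at time \<open>0\<close>;
  prior quantities and gains exist from time \<open>1\<close> on.
\<close>

definition kalman_estimates ::
    "real \<Rightarrow> real^('c::finite + 'm::finite)^'d \<Rightarrow> real^('c + 'm)
      \<Rightarrow> (nat \<Rightarrow> real^'d^(2 \<times> 'd + 'm)) \<Rightarrow> (nat \<Rightarrow> real^'d^2)
      \<Rightarrow> (nat \<Rightarrow> real^('c + 'm)) \<Rightarrow> (nat \<Rightarrow> real^'d)
      \<Rightarrow> (nat \<Rightarrow> real^(2 \<times> 'd + 'm)) \<Rightarrow> (nat \<Rightarrow> real^2)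
      \<Rightarrow> (nat \<Rightarrow> real^(2 \<times> 'd + 'm)) \<Rightarrow> (nat \<Rightarrow> real^2) \<Rightarrow> bool" where
  "kalman_estimates \<tau> V q Lo Lob u y ho_m hob_m ho hob \<longleftrightarrow> (\<forall>k\<ge>1.
      vjoin (ho_m k) (hob_m k) =
        block (A_oo \<tau> V) 0 (A_obo \<tau> q) (A_mat \<tau>) *v vjoin (ho (k - 1)) (hob (k - 1))
        + vstack (B_o \<tau> V) (B_ob \<tau> q) *v u (k - 1) \<and>
      vjoin (ho k) (hob k) =
        vjoin (ho_m k) (hob_m k) + vstack (Lo k) (Lob k) *v (y k - C_o *v ho_m k))"

definition kalman_gain :: "real \<Rightarrow> real^(2 \<times> 'd::finite + 'm::finite)^(2 \<times> 'd + 'm) \<Rightarrow> real^(2 \<times> 'd + 'm)^'e \<Rightarrow> real^'d^'e" where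
  "kalman_gain r Poo P =
     P ** transpose C_o ** matrix_inv (C_o ** Poo ** transpose C_o + r *\<^sub>R mat 1)"

definition kalman_covariances ::
    "real \<Rightarrow> real \<Rightarrow> real^('c::finite + 'm::finite)^'d \<Rightarrow> real^('c + 'm)
      \<Rightarrow> real^(2 \<times> ('c + 'm) + 'm)^(2 \<times> ('c + 'm) + 'm)
      \<Rightarrow> (nat \<Rightarrow> real^(2 \<times> 'd + 'm)^(2 \<times> 'd + 'm)) \<Rightarrow> (nat \<Rightarrow> real^(2 \<times> 'd + 'm)^2)
      \<Rightarrow> (nat \<Rightarrow> real^(2 \<times> 'd + 'm)^(2 \<times> 'd + 'm)) \<Rightarrow> (nat \<Rightarrow> real^(2 \<times> 'd + 'm)^2)
      \<Rightarrow> (nat \<Rightarrow> real^'d^(2 \<times> 'd + 'm)) \<Rightarrow> (nat \<Rightarrow> real^'d^2) \<Rightarrow> bool" where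
  "kalman_covariances \<tau> r V q Q Poo_m Pob_m Poo Pob Lo Lob \<longleftrightarrow> (\<forall>k\<ge>1.
      Poo_m k = A_oo \<tau> V ** Poo (k - 1) ** transpose (A_oo \<tau> V) + T_o V ** Q ** transpose (T_o V) \<and>
      Pob_m k = (A_obo \<tau> q ** Poo (k - 1) + A_mat \<tau> ** Pob (k - 1)) ** transpose (A_oo \<tau> V)
                + T_ob q ** Q ** transpose (T_o V) \<and>
      Lo k = kalman_gain r (Poo_m k) (Poo_m k) \<and>
      Lob k = kalman_gain r (Poo_m k) (Pob_m k) \<and>
      Poo k = (mat 1 - Lo k ** C_o) ** Poo_m k \<and>
      Pob k = Pob_m k ** (mat 1 - transpose C_o ** transpose (Lo k)))"

text \<open>
  The time-varying Kalman filter on the probability space \<open>\<Omega>\<close>.  Its covariance recursion starts at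
  the error covariances of the initial estimates, and the initial error is independent of all
  noise that acts afterwards.
\<close>

definition time_varying_kalman_filter ::
    "'w measure \<Rightarrow> real \<Rightarrow> real \<Rightarrow> real^('c::finite + 'm::finite)^'d \<Rightarrow> real^('c + 'm)
      \<Rightarrow> real^(2 \<times> ('c + 'm) + 'm)^(2 \<times> ('c + 'm) + 'm)
      \<Rightarrow> (nat \<Rightarrow> 'w \<Rightarrow> real^(2 \<times> ('c + 'm) + 'm)) \<Rightarrow> (nat \<Rightarrow> 'w \<Rightarrow> real^'d)
      \<Rightarrow> (nat \<Rightarrow> 'w \<Rightarrow> real^('c + 'm)) \<Rightarrow> (nat \<Rightarrow> 'w \<Rightarrow> real^'d)
      \<Rightarrow> (nat \<Rightarrow> 'w \<Rightarrow> real^(2 \<times> 'd + 'm)) \<Rightarrow> (nat \<Rightarrow> 'w \<Rightarrow> real^2)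
      \<Rightarrow> (nat \<Rightarrow> 'w \<Rightarrow> real^(2 \<times> 'd + 'm)) \<Rightarrow> (nat \<Rightarrow> 'w \<Rightarrow> real^2)
      \<Rightarrow> (nat \<Rightarrow> 'w \<Rightarrow> real^(2 \<times> 'd + 'm)) \<Rightarrow> (nat \<Rightarrow> 'w \<Rightarrow> real^2)
      \<Rightarrow> (nat \<Rightarrow> real^(2 \<times> 'd + 'm)^(2 \<times> 'd + 'm)) \<Rightarrow> (nat \<Rightarrow> real^(2 \<times> 'd + 'm)^2)
      \<Rightarrow> (nat \<Rightarrow> real^(2 \<times> 'd + 'm)^(2 \<times> 'd + 'm)) \<Rightarrow> (nat \<Rightarrow> real^(2 \<times> 'd + 'm)^2)
      \<Rightarrow> (nat \<Rightarrow> real^'d^(2 \<times> 'd + 'm)) \<Rightarrow> (nat \<Rightarrow> real^'d^2) \<Rightarrow> bool" where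
  "time_varying_kalman_filter \<Omega> \<tau> r V q Q v w u y eo eob
      ho_m hob_m ho hob Poo_m Pob_m Poo Pob Lo Lob \<longleftrightarrow>
    (let err_o = (\<lambda>\<omega>. eo 0 \<omega> - ho 0 \<omega>); err_ob = (\<lambda>\<omega>. eob 0 \<omega> - hob 0 \<omega>) in
      square_integrable \<Omega> err_o \<and> square_integrable \<Omega> err_ob \<and>
      independent_rv \<Omega> borel (\<lambda>\<omega>. (err_o \<omega>, err_ob \<omega>))
        (\<Pi>\<^sub>M k\<in>UNIV. borel) (\<lambda>\<omega> k. (v k \<omega>, w (Suc k) \<omega>)) \<and>
      Poo 0 = covariance_mat \<Omega> err_o err_o \<and> Pob 0 = covariance_mat \<Omega> err_ob err_o) \<and>
    kalman_covariances \<tau> r V q Q Poo_m Pob_m Poo Pob Lo Lob \<and>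
    (\<forall>\<omega>\<in>space \<Omega>. kalman_estimates \<tau> V q Lo Lob (\<lambda>k. u k \<omega>) (\<lambda>k. y k \<omega>)
       (\<lambda>k. ho_m k \<omega>) (\<lambda>k. hob_m k \<omega>) (\<lambda>k. ho k \<omega>) (\<lambda>k. hob k \<omega>))"

text \<open>
  The steady-state Kalman filter belonging to time-varying gains \<open>Lo\<close> and \<open>Lob\<close>: both gains
  converge, and the estimates are propagated with the limits as constant gains.
\<close>

definition steady_state_kalman_filter ::
    "real \<Rightarrow> real^('c::finite + 'm::finite)^'d \<Rightarrow> real^('c + 'm)
      \<Rightarrow> (nat \<Rightarrow> real^'d^(2 \<times> 'd + 'm)) \<Rightarrow> (nat \<Rightarrow> real^'d^2)
      \<Rightarrow> (nat \<Rightarrow> real^('c + 'm)) \<Rightarrow> (nat \<Rightarrow> real^'d)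
      \<Rightarrow> (nat \<Rightarrow> real^(2 \<times> 'd + 'm)) \<Rightarrow> (nat \<Rightarrow> real^2)
      \<Rightarrow> (nat \<Rightarrow> real^(2 \<times> 'd + 'm)) \<Rightarrow> (nat \<Rightarrow> real^2) \<Rightarrow> bool" where
  "steady_state_kalman_filter \<tau> V q Lo Lob u y ho_m hob_m ho hob \<longleftrightarrow>
    convergent Lo \<and> convergent Lob \<and>
    kalman_estimates \<tau> V q (\<lambda>_. lim Lo) (\<lambda>_. lim Lob) u y ho_m hob_m ho hob"

end

theory Submission
  imports Defs
begin

text \<open>
  If the prior covariance \<open>P\<close> is positive semidefinite, then so is the posterior one, by Joseph's form
  \<open>(I - L C) P = (I - L C) P (I - L C)\<^sup>T + r L L\<^sup>T\<close>; hence so are all the prior covariances and their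
  limit, provided the initial covariance is.  Therefore the innovation covariances
  \<open>C P C\<^sup>T + r I\<close> and their limit are invertible, matrix inversion is continuous at the limit, the
  gains converge, and the steady-state equations are the limits of the covariance recursions.
\<close>

section \<open>Matrix algebra and limits\<close>

lemma matrix_mult_distribs:
  fixes A A' :: "real^'n^'m" and B B' :: "real^'p^'n"
  shows "(A + A') ** B = A ** B + A' ** B"
    and "(A - A') ** B = A ** B - A' ** B"
    and "A ** (B + B') = A ** B + A ** B'"
    and "A ** (B - B') = A ** B - A ** B'"
  by (simp_all add: matrix_matrix_mult_def vec_eq_iff algebra_simps sum.distrib sum_subtractf)

lemma matrix_inv:
  fixes A :: "real^'n^'m"
  assumes "invertible A"
  shows "A ** matrix_inv A = mat 1" and "matrix_inv A ** A = mat 1"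
proof -
  have "A ** matrix_inv A = mat 1 \<and> matrix_inv A ** A = mat 1"
    using assms unfolding matrix_inv_def invertible_def by (rule someI_ex)
  then show "A ** matrix_inv A = mat 1" and "matrix_inv A ** A = mat 1" by simp_all
qed

lemma tendsto_matrix_mult [tendsto_intros]:
  fixes X :: "'x \<Rightarrow> real^'n::finite^'m" and Y :: "'x \<Rightarrow> real^'p^'n"
  assumes "(X \<longlongrightarrow> a) F" "(Y \<longlongrightarrow> b) F"
  shows "((\<lambda>k. X k ** Y k) \<longlongrightarrow> a ** b) F"
  unfolding matrix_matrix_mult_def
  by (intro vec_tendstoI) (simp, intro tendsto_intros assms)

lemma tendsto_matrix_vector_mult [tendsto_intros]:
  fixes X :: "'x \<Rightarrow> real^'n::finite^'m" and Y :: "'x \<Rightarrow> real^'n"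
  assumes "(X \<longlongrightarrow> a) F" "(Y \<longlongrightarrow> b) F"
  shows "((\<lambda>k. X k *v Y k) \<longlongrightarrow> a *v b) F"
  unfolding matrix_vector_mult_def
  by (intro vec_tendstoI) (simp, intro tendsto_intros assms)

lemma tendsto_transpose [tendsto_intros]:
  fixes X :: "'x \<Rightarrow> real^'n^'m"
  assumes "(X \<longlongrightarrow> a) F"
  shows "((\<lambda>k. transpose (X k)) \<longlongrightarrow> transpose a) F"
  unfolding transpose_def
  by (intro vec_tendstoI) (simp, intro tendsto_intros assms)

lemma tendsto_det [tendsto_intros]:
  fixes X :: "'x \<Rightarrow> real^'n^'n"
  assumes "(X \<longlongrightarrow> a) F"
  shows "((\<lambda>k. det (X k)) \<longlongrightarrow> det a) F"
  unfolding det_def by (intro tendsto_intros assms)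

text \<open>Cramer's rule for column \<open>j\<close> of the inverse, the solution of
  \<open>A *v x = axis j 1\<close>. Each entry becomes a quotient of determinants, which reduces
  continuity of inversion to continuity of \<open>det\<close>.\<close>

lemma matrix_inv_nth:
  fixes A :: "real^'n^'n"
  assumes "invertible A"
  shows "matrix_inv A $ i $ j =
    det (\<chi> k l. if l = i then axis j 1 $ k else A $ k $ l) / det A"
proof -
  have "A *v (matrix_inv A *v axis j 1) = axis j 1"
    by (simp add: matrix_vector_mul_assoc matrix_inv assms)
  then have "matrix_inv A *v axis j 1 =
      (\<chi> i. det (\<chi> k l. if l = i then axis j 1 $ k else A $ k $ l) / det A)"
    using assms by (simp add: cramer invertible_det_nz)
  moreover have "(matrix_inv A *v axis j 1) $ i = matrix_inv A $ i $ j"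
    by (simp add: matrix_vector_mult_basis column_def)
  ultimately show ?thesis by simp
qed

lemma tendsto_matrix_inv:
  fixes X :: "'x \<Rightarrow> real^'n^'n"
  assumes lim: "(X \<longlongrightarrow> a) F" and inv: "\<forall>\<^sub>F k in F. invertible (X k)" "invertible a"
  shows "((\<lambda>k. matrix_inv (X k)) \<longlongrightarrow> matrix_inv a) F"
proof (intro vec_tendstoI)
  fix i j
  have "((\<lambda>k. (\<chi> m l. if l = i then axis j 1 $ m else X k $ m $ l) :: real^'n^'n)
      \<longlongrightarrow> (\<chi> m l. if l = i then axis j 1 $ m else a $ m $ l)) F"
    by (intro vec_tendstoI) (auto intro!: tendsto_intros lim)
  then have "((\<lambda>k. det (\<chi> m l. if l = i then axis j 1 $ m else X k $ m $ l) / det (X k))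
      \<longlongrightarrow> matrix_inv a $ i $ j) F"
    unfolding matrix_inv_nth[OF inv(2)]
    using inv(2) by (intro tendsto_divide tendsto_det lim) (simp_all add: invertible_det_nz)
  then show "((\<lambda>k. matrix_inv (X k) $ i $ j) \<longlongrightarrow> matrix_inv a $ i $ j) F"
    \<comment> \<open>The quotient is known to be the entry of the inverse only where
      \<open>X k\<close> is invertible, that is, eventually.\<close>
    by (rule Lim_transform_eventually) (use inv(1) in \<open>simp add: eventually_mono matrix_inv_nth\<close>)
qed


section \<open>Positive semidefinite matrices\<close>

text \<open>Symmetry is not part of the definition: Joseph's form does not need it.\<close>

definition psd :: "real^'n^'n \<Rightarrow> bool" where
  "psd S \<longleftrightarrow> (\<forall>a. 0 \<le> a \<bullet> (S *v a))"

lemma psd_add: "psd X \<Longrightarrow> psd Y \<Longrightarrow> psd (X + Y)"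
  by (simp add: psd_def matrix_vector_mult_add_rdistrib inner_add_right)

lemma psd_scale: "0 \<le> c \<Longrightarrow> psd X \<Longrightarrow> psd (c *\<^sub>R X)"
  by (simp add: psd_def scaleR_matrix_vector_assoc[symmetric])

text \<open>The form of \<open>A ** X ** transpose A\<close> at \<open>a\<close> is the form of
  \<open>X\<close> at \<open>transpose A *v a\<close>. Prediction, innovation and Joseph's form all
  consist of such terms.\<close>

lemma psd_congruence:
  fixes X :: "real^'n^'n" and A :: "real^'n^'m"
  assumes "psd X"
  shows "psd (A ** X ** transpose A)"
proof -
  have "a \<bullet> ((A ** X ** transpose A) *v a) = (transpose A *v a) \<bullet> (X *v (transpose A *v a))" for a
    by (simp add: dot_lmul_matrix flip: matrix_vector_mul_assoc)
  then show ?thesis using assms by (simp add: psd_def)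
qed

lemma psd_mat_1: "psd (mat 1)"
  by (simp add: psd_def)

text \<open>For a fixed vector the quadratic form is continuous in the matrix, and the half-line of
  nonnegative reals is closed.\<close>

lemma psd_tendsto:
  fixes X :: "'x \<Rightarrow> real^'n^'n"
  assumes "F \<noteq> bot" "(X \<longlongrightarrow> a) F" "\<forall>\<^sub>F k in F. psd (X k)"
  shows "psd a"
  unfolding psd_def
proof
  fix b
  have lim: "((\<lambda>k. b \<bullet> (X k *v b)) \<longlongrightarrow> b \<bullet> (a *v b)) F"
    by (intro tendsto_intros assms)
  have "\<forall>\<^sub>F k in F. 0 \<le> b \<bullet> (X k *v b)"
    using assms(3) by (rule eventually_mono) (simp add: psd_def)
  then show "0 \<le> b \<bullet> (a *v b)"
    by (rule tendsto_lowerbound[OF lim _ assms(1)])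
qed

text \<open>The quadratic form of the sum is at least \<open>r * (a \<bullet> a)\<close>, so the
  kernel is trivial.\<close>

lemma invertible_psd_add_scaled_mat_1:
  fixes S :: "real^'n^'n"
  assumes "psd S" "0 < r"
  shows "invertible (S + r *\<^sub>R mat 1)"
proof -
  have "a = 0" if "(S + r *\<^sub>R mat 1) *v a = 0" for a
  proof -
    have "0 = a \<bullet> (S *v a) + r * (a \<bullet> a)"
      using arg_cong[OF that, of "inner a"]
      by (simp add: matrix_vector_mult_add_rdistrib inner_add_right scaleR_matrix_vector_assoc[symmetric])
    moreover have "0 \<le> a \<bullet> (S *v a)" "0 \<le> r * (a \<bullet> a)"
      using assms by (simp_all add: psd_def)
    ultimately have "r * (a \<bullet> a) = 0" by linarith
    then show ?thesis using assms by simp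
  qed
  then show ?thesis
    by (simp add: invertible_left_inverse matrix_left_invertible_ker)
qed

text \<open>The hypothesis is the gain formula cleared of its inverse. Multiplied by
  \<open>transpose L\<close> on the right, it says that \<open>L C P C^T L^T + r L L^T\<close>
  equals \<open>P C^T L^T\<close>; these are exactly the terms by which the two sides
  differ.\<close>

lemma joseph_form:
  fixes P :: "real^'n^'n" and C :: "real^'n^'d" and L :: "real^'d^'n"
  assumes L: "L ** (C ** P ** transpose C + r *\<^sub>R mat 1) = P ** transpose C"
  shows "(mat 1 - L ** C) ** P =
    (mat 1 - L ** C) ** P ** transpose (mat 1 - L ** C) + r *\<^sub>R (L ** transpose L)"
proof -
  have "L ** (C ** P ** transpose C + r *\<^sub>R mat 1) ** transpose L = P ** transpose C ** transpose L"
    by (simp add: L)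
  then have "L ** C ** P ** transpose C ** transpose L + r *\<^sub>R (L ** transpose L)
      = P ** transpose C ** transpose L"
    by (simp add: matrix_mult_distribs matrix_mul_assoc
        matrix_scalar_ac scalar_matrix_assoc)
  moreover have "transpose (mat 1 - L ** C) = mat 1 - transpose C ** transpose L"
    by (simp add: transpose_def vec_eq_iff matrix_matrix_mult_def mat_def mult.commute)
  ultimately show ?thesis
    by (simp add: matrix_mult_distribs matrix_mul_assoc)
qed

text \<open>The quadratic form at \<open>a\<close> is the variance of \<open>a \<bullet> X\<close>,
  the integral of a square.\<close>

lemma psd_covariance_mat:
  assumes "prob_space \<Omega>" "square_integrable \<Omega> X"
  shows "psd (covariance_mat \<Omega> X X)"
  unfolding psd_def
proof
  fix a
  interpret prob_space \<Omega> by fact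
  have meas [measurable]: "X \<in> borel_measurable \<Omega>"
    and int: "integrable \<Omega> (\<lambda>\<omega>. (norm (X \<omega>))\<^sup>2)"
    using assms by (simp_all add: square_integrable_def)
  have nth [measurable]: "(\<lambda>\<omega>. X \<omega> $ i) \<in> borel_measurable \<Omega>" for i
    using borel_measurable_inner[OF meas borel_measurable_const, of "axis i 1"]
    by (simp add: inner_axis)
  \<comment> \<open>Both coordinates are bounded by the norm, so the product is dominated by its
    square.\<close>
  have prod: "integrable \<Omega> (\<lambda>\<omega>. X \<omega> $ i * X \<omega> $ j)" for i j
    by (rule Bochner_Integration.integrable_bound[OF int])
      (auto simp: abs_mult power2_eq_square intro!: AE_I2 mult_mono component_le_norm_cart)
  have single: "integrable \<Omega> (\<lambda>\<omega>. X \<omega> $ i)" for i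
    by (rule square_integrable_imp_integrable) (use prod[of i i] in \<open>simp_all add: power2_eq_square\<close>)
  define D where "D i \<omega> = X \<omega> $ i - (\<integral>\<omega>'. X \<omega>' $ i \<partial>\<Omega>)" for i \<omega>
  \<comment> \<open>Integrability of the centred products justifies pulling the finite sums into the
    integral below.\<close>
  have D: "integrable \<Omega> (\<lambda>\<omega>. D i \<omega> * D j \<omega>)" for i j
    unfolding D_def using prod single by (simp add: algebra_simps)
  have "a \<bullet> (covariance_mat \<Omega> X X *v a) = (\<Sum>i\<in>UNIV. \<Sum>j\<in>UNIV. a $ i * a $ j * (\<integral>\<omega>. D i \<omega> * D j \<omega> \<partial>\<Omega>))"
    by (simp add: inner_vec_def matrix_vector_mult_def covariance_mat_def D_def sum_distrib_left mult_ac)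
  also have "\<dots> = (\<integral>\<omega>. (\<Sum>i\<in>UNIV. \<Sum>j\<in>UNIV. a $ i * a $ j * (D i \<omega> * D j \<omega>)) \<partial>\<Omega>)"
    using D by simp
  also have "\<dots> = (\<integral>\<omega>. (\<Sum>i\<in>UNIV. a $ i * D i \<omega>)\<^sup>2 \<partial>\<Omega>)"
    by (simp add: power2_eq_square sum_product mult_ac)
  also have "\<dots> \<ge> 0" by simp
  finally show "0 \<le> a \<bullet> (covariance_mat \<Omega> X X *v a)" .
qed

text \<open>A characteristic function is bounded by \<open>1\<close>.\<close>

lemma psd_gaussian_vector:
  assumes "prob_space \<Omega>" "gaussian_vector \<Omega> X S"
  shows "psd S"
  unfolding psd_def
proof
  fix a
  interpret prob_space \<Omega> by fact
  have [measurable]: "X \<in> borel_measurable \<Omega>"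
    and ch: "char (distr \<Omega> borel (\<lambda>\<omega>. a \<bullet> X \<omega>)) 1 = of_real (exp (- (a \<bullet> (S *v a) / 2)))"
    using assms(2) by (simp_all add: gaussian_vector_def)
  interpret D: real_distribution "distr \<Omega> borel (\<lambda>\<omega>. a \<bullet> X \<omega>)"
    by (rule real_distribution_distr) simp
  \<comment> \<open>At argument 1 the modulus is the exponential of minus half the quadratic form;
    being at most 1, it forces the form to be nonnegative.\<close>
  have "norm (char (distr \<Omega> borel (\<lambda>\<omega>. a \<bullet> X \<omega>)) 1) \<le> 1"
    by (rule D.cmod_char_le_1)
  then show "0 \<le> a \<bullet> (S *v a)"
    unfolding ch by simp
qed


section \<open>Kalman recursions and their limits\<close>

text \<open>Every gain contains \<open>matrix_inv\<close> of this matrix, whose value is determined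
  only when the matrix is invertible.\<close>

lemma invertible_innovation:
  assumes "psd P" "0 < r"
  shows "invertible (C ** P ** transpose C + r *\<^sub>R mat 1)"
  using assms by (intro invertible_psd_add_scaled_mat_1 psd_congruence)

lemma psd_posterior_covariance:
  assumes "psd P" "0 < r"
  shows "psd ((mat 1 - kalman_gain r P P ** C_o) ** P)"
proof -
  have "kalman_gain r P P ** (C_o ** P ** transpose C_o + r *\<^sub>R mat 1) = P ** transpose C_o"
    by (simp add: kalman_gain_def matrix_inv invertible_innovation[OF assms]
        flip: matrix_mul_assoc[of _ "matrix_inv _"])
  then show ?thesis
    using psd_congruence[OF psd_mat_1, of "kalman_gain r P P"] assms
    \<comment> \<open>The term \<open>L ** transpose L\<close> is the congruence of
      \<open>mat 1\<close> by the gain.\<close>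
    by (subst joseph_form) (auto intro!: psd_add psd_congruence psd_scale)
qed

text \<open>Semidefiniteness passes to the limit \<open>P\<close>, so the innovation matrices are
  invertible eventually and at the limit. The separate sequence \<open>Pob\<close> lets one lemma
  cover both gains.\<close>

lemma tendsto_kalman_gain:
  assumes "F \<noteq> bot" "(Poo \<longlongrightarrow> P) F" "(Pob \<longlongrightarrow> P') F" "\<forall>\<^sub>F k in F. psd (Poo k)" "0 < r"
  shows "((\<lambda>k. kalman_gain r (Poo k) (Pob k)) \<longlongrightarrow> kalman_gain r P P') F"
proof -
  have "psd P" by (rule psd_tendsto[OF assms(1,2,4)])
  then show ?thesis
    unfolding kalman_gain_def
    by (intro tendsto_intros tendsto_matrix_inv assms)
      (use assms(4,5) in \<open>auto elim!: eventually_mono intro!: invertible_innovation\<close>)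
qed

lemma psd_prior_covariance:
  assumes rec: "kalman_covariances \<tau> r V q Q Poo_m Pob_m Poo Pob Lo Lob"
    and "psd (Poo 0)" "psd Q" "0 < r"
  shows "psd (Poo_m (Suc k))"
proof -
  have step: "psd (Poo_m (Suc k))" if "psd (Poo k)" for k
    using rec that \<open>psd Q\<close> by (auto simp: kalman_covariances_def intro!: psd_add psd_congruence)
  \<comment> \<open>The induction runs over posterior covariances: they start at time 0, and each
    determines the next prior.\<close>
  have "psd (Poo k)" for k
  proof (induction k)
    case (Suc k)
    have "Poo (Suc k) = (mat 1 - kalman_gain r (Poo_m (Suc k)) (Poo_m (Suc k)) ** C_o) ** Poo_m (Suc k)"
      using rec by (simp add: kalman_covariances_def)
    then show ?case
      using psd_posterior_covariance[OF step[OF Suc] \<open>0 < r\<close>] by simp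
  qed fact
  then show ?thesis by (rule step)
qed

theorem theorem1:
  fixes \<Omega> :: "'w measure"
    and \<tau> r :: real
    and s1 s2 :: "real^('c::finite + 'm::finite)" and s3 :: "real^'m"
    and V :: "real^('c + 'm)^'d::finite"
    and q :: "real^('c + 'm)" and W :: "real^'d^('c + 'm)"
    and Poo_star :: "real^(2 \<times> 'd + 'm)^(2 \<times> 'd + 'm)"
    and Pob_star :: "real^(2 \<times> 'd + 'm)^2"
  assumes ensemble: "mixed_clock_ensemble \<Omega> \<tau> r s1 s2 s3 V x z u y vx vz w"
    and weights: "decomposition_weights V q W"
    and decomposition: "\<And>k \<omega>. \<omega> \<in> space \<Omega> \<Longrightarrow>
      vjoin (x k \<omega>) (z k \<omega>) = T_inv V W *v vjoin (eo k \<omega>) (eob k \<omega>)"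
    and filter: "time_varying_kalman_filter \<Omega> \<tau> r V q (Q_mat \<tau> s1 s2 s3)
      (\<lambda>k \<omega>. vjoin (vx k \<omega>) (vz k \<omega>)) w u y eo eob
      ho_m hob_m ho hob Poo_m Pob_m Poo Pob Lo Lob"
    and steady_oo: "Poo_m \<longlonglongrightarrow> Poo_star"
    and steady_ob: "Pob_m \<longlonglongrightarrow> Pob_star"
  shows "let
      Lo_star = Poo_star ** transpose C_o **
        matrix_inv (C_o ** Poo_star ** transpose C_o + r *\<^sub>R mat 1);
      Lob_star = Pob_star ** transpose C_o **
        matrix_inv (C_o ** Poo_star ** transpose C_o + r *\<^sub>R mat 1)
    in
      Lo \<longlonglongrightarrow> Lo_star \<and> Lob \<longlonglongrightarrow> Lob_star \<and>
      (\<forall>\<omega>\<in>space \<Omega>. \<forall>go_m gob_m go gob.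
        steady_state_kalman_filter \<tau> V q Lo Lob (\<lambda>k. u k \<omega>) (\<lambda>k. y k \<omega>) go_m gob_m go gob \<longleftrightarrow>
        (\<forall>k\<ge>1.
          vjoin (go_m k) (gob_m k) =
            block (A_oo \<tau> V) 0 (A_obo \<tau> q) (A_mat \<tau>) *v vjoin (go (k - 1)) (gob (k - 1))
            + vstack (B_o \<tau> V) (B_ob \<tau> q) *v u (k - 1) \<omega> \<and>
          vjoin (go k) (gob k) =
            vjoin (go_m k) (gob_m k) + vstack Lo_star Lob_star *v (y k \<omega> - C_o *v go_m k))) \<and>
      Poo_star = T_o V ** Q_mat \<tau> s1 s2 s3 ** transpose (T_o V)
        + A_oo \<tau> V ** Poo_star ** transpose (A_oo \<tau> V)
        - A_oo \<tau> V ** Poo_star ** transpose C_o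
          ** matrix_inv (C_o ** Poo_star ** transpose C_o + r *\<^sub>R mat 1)
          ** C_o ** Poo_star ** transpose (A_oo \<tau> V) \<and>
      Pob_star = T_ob q ** Q_mat \<tau> s1 s2 s3 ** transpose (T_o V)
        + A_mat \<tau> ** Pob_star ** transpose (A_oo \<tau> V)
        - A_mat \<tau> ** Pob_star ** transpose C_o ** transpose Lo_star ** transpose (A_oo \<tau> V)
        + A_obo \<tau> q ** Poo_star ** transpose (A_oo \<tau> V)
        - A_obo \<tau> q ** Lo_star ** C_o ** Poo_star ** transpose (A_oo \<tau> V)"
proof -
  define Lo_star where "Lo_star = kalman_gain r Poo_star Poo_star"
  define Lob_star where "Lob_star = kalman_gain r Poo_star Pob_star"
  let ?Q = "Q_mat \<tau> s1 s2 s3"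
  have "prob_space \<Omega>" "0 < r"
    and "gaussian_vector \<Omega> (\<lambda>\<omega>. vjoin (vx 0 \<omega>) (vz 0 \<omega>)) ?Q"
    using ensemble by (simp_all add: mixed_clock_ensemble_def clock_noise_def)
  \<comment> \<open>Semidefiniteness is read off the Gaussian noise at time 0, without inspecting
    the blocks of \<open>Q_mat\<close>.\<close>
  then have Q: "psd ?Q" by (blast intro: psd_gaussian_vector)
  have rec: "kalman_covariances \<tau> r V q ?Q Poo_m Pob_m Poo Pob Lo Lob"
    using filter by (simp add: time_varying_kalman_filter_def)
  have "psd (Poo 0)"
    using filter psd_covariance_mat[OF \<open>prob_space \<Omega>\<close>]
    by (auto simp: time_varying_kalman_filter_def Let_def)
  then have psd: "psd (Poo_m (Suc k))" for k
    using psd_prior_covariance[OF rec] Q \<open>0 < r\<close> by simp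
  \<comment> \<open>The recursions constrain priors and gains only from time 1 on, so limits are
    taken along \<open>Suc k\<close> and shifted back for the gains.\<close>
  have oo: "(\<lambda>k. Poo_m (Suc k)) \<longlonglongrightarrow> Poo_star" and ob: "(\<lambda>k. Pob_m (Suc k)) \<longlonglongrightarrow> Pob_star"
    by (rule LIMSEQ_Suc steady_oo steady_ob)+
  have Lo: "(\<lambda>k. Lo (Suc k)) \<longlonglongrightarrow> Lo_star" and Lob: "(\<lambda>k. Lob (Suc k)) \<longlonglongrightarrow> Lob_star"
    using tendsto_kalman_gain[OF _ oo oo _ \<open>0 < r\<close>] tendsto_kalman_gain[OF _ oo ob _ \<open>0 < r\<close>] psd rec
    by (simp_all add: kalman_covariances_def Lo_star_def Lob_star_def)
  then have gains: "Lo \<longlonglongrightarrow> Lo_star" "Lob \<longlonglongrightarrow> Lob_star"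
    by (simp_all add: LIMSEQ_imp_Suc)

  have posterior_oo: "(\<lambda>k. Poo (Suc k)) \<longlonglongrightarrow> (mat 1 - Lo_star ** C_o) ** Poo_star"
    and posterior_ob: "(\<lambda>k. Pob (Suc k)) \<longlonglongrightarrow> Pob_star ** (mat 1 - transpose C_o ** transpose Lo_star)"
    using rec tendsto_matrix_mult[OF tendsto_diff[OF tendsto_const tendsto_matrix_mult[OF Lo tendsto_const]] oo]
      tendsto_matrix_mult[OF ob tendsto_diff[OF tendsto_const tendsto_matrix_mult[OF tendsto_const tendsto_transpose[OF Lo]]]]
    by (simp_all add: kalman_covariances_def)
  \<comment> \<open>The double shift is needed because \<open>Poo 0\<close> and \<open>Pob 0\<close>
    are initial data rather than results of a measurement update.\<close>
  have prior: "Poo_m (Suc (Suc k)) = A_oo \<tau> V ** Poo (Suc k) ** transpose (A_oo \<tau> V)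
        + T_o V ** ?Q ** transpose (T_o V)"
      "Pob_m (Suc (Suc k)) = (A_obo \<tau> q ** Poo (Suc k) + A_mat \<tau> ** Pob (Suc k)) ** transpose (A_oo \<tau> V)
        + T_ob q ** ?Q ** transpose (T_o V)" for k
    using rec by (simp_all add: kalman_covariances_def)
  have "(\<lambda>k. Poo_m (Suc (Suc k))) \<longlonglongrightarrow>
      A_oo \<tau> V ** ((mat 1 - Lo_star ** C_o) ** Poo_star) ** transpose (A_oo \<tau> V)
        + T_o V ** ?Q ** transpose (T_o V)"
    unfolding prior by (intro tendsto_intros posterior_oo)
  \<comment> \<open>The shifted priors converge both to \<open>Poo_star\<close> and to the limit of
    the recursion; uniqueness of limits gives the fixed-point equation, and likewise for
    \<open>Pob_star\<close> below.\<close>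
  then have eq_oo: "Poo_star =
      A_oo \<tau> V ** ((mat 1 - Lo_star ** C_o) ** Poo_star) ** transpose (A_oo \<tau> V)
        + T_o V ** ?Q ** transpose (T_o V)"
    by (rule LIMSEQ_unique[OF LIMSEQ_Suc[OF oo]])
  have "(\<lambda>k. Pob_m (Suc (Suc k))) \<longlonglongrightarrow>
      (A_obo \<tau> q ** ((mat 1 - Lo_star ** C_o) ** Poo_star)
        + A_mat \<tau> ** (Pob_star ** (mat 1 - transpose C_o ** transpose Lo_star)))
        ** transpose (A_oo \<tau> V) + T_ob q ** ?Q ** transpose (T_o V)"
    unfolding prior by (intro tendsto_intros posterior_oo posterior_ob)
  then have eq_ob: "Pob_star =
      (A_obo \<tau> q ** ((mat 1 - Lo_star ** C_o) ** Poo_star)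
        + A_mat \<tau> ** (Pob_star ** (mat 1 - transpose C_o ** transpose Lo_star)))
        ** transpose (A_oo \<tau> V) + T_ob q ** ?Q ** transpose (T_o V)"
    by (rule LIMSEQ_unique[OF LIMSEQ_Suc[OF ob]])

  have riccati: "Poo_star = T_o V ** ?Q ** transpose (T_o V)
        + A_oo \<tau> V ** Poo_star ** transpose (A_oo \<tau> V)
        - A_oo \<tau> V ** Poo_star ** transpose C_o
          ** matrix_inv (C_o ** Poo_star ** transpose C_o + r *\<^sub>R mat 1)
          ** C_o ** Poo_star ** transpose (A_oo \<tau> V)"
    by (subst eq_oo)
      (simp add: Lo_star_def kalman_gain_def matrix_mult_distribs matrix_mul_assoc)
  have cross: "Pob_star = T_ob q ** ?Q ** transpose (T_o V)
        + A_mat \<tau> ** Pob_star ** transpose (A_oo \<tau> V)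
        - A_mat \<tau> ** Pob_star ** transpose C_o ** transpose Lo_star ** transpose (A_oo \<tau> V)
        + A_obo \<tau> q ** Poo_star ** transpose (A_oo \<tau> V)
        - A_obo \<tau> q ** Lo_star ** C_o ** Poo_star ** transpose (A_oo \<tau> V)"
    by (subst eq_ob)
      (simp add: matrix_mult_distribs matrix_mul_assoc)
  \<comment> \<open>Since the gains converge, the convergence clauses hold and each
    \<open>lim\<close> is the starred gain, which makes this an equivalence.\<close>
  have steady: "steady_state_kalman_filter \<tau> V q Lo Lob (\<lambda>k. u k \<omega>) (\<lambda>k. y k \<omega>) go_m gob_m go gob \<longleftrightarrow>
      kalman_estimates \<tau> V q (\<lambda>_. Lo_star) (\<lambda>_. Lob_star) (\<lambda>k. u k \<omega>) (\<lambda>k. y k \<omega>) go_m gob_m go gob"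
    for \<omega> go_m gob_m go gob
    using gains by (auto simp: steady_state_kalman_filter_def limI convergent_def)
  show ?thesis
    \<comment> \<open>The gains spelled out in the statement are folded back into
      \<open>Lo_star\<close> and \<open>Lob_star\<close>.\<close>
    unfolding Let_def Lo_star_def[unfolded kalman_gain_def, symmetric]
      Lob_star_def[unfolded kalman_gain_def, symmetric]
    by (intro conjI gains riccati cross) (simp add: steady kalman_estimates_def)
qed

end
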